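(* Let $\mathbb{F}$ be any field, let $\mathcal{L}$ be a finite dimensional split local $\mathbb{F}$-algebra with Jacobson radical $\mathbf{J}(\mathcal{L})$, and set $n=\dim_{\mathbb{F}}\mathbf{J}(\mathcal{L})$. Then, with respect to the product in $\mathcal{L}$, the subset $$R=1+\mathbf{J}(\mathcal{L})=\{1+v:v\in\mathbf{J}(\mathcal{L})\}$$ is a group, isomorphic to a regular subgroup $R'$ of $\mathrm{AGL}_n(\mathbb{F})$ for which $\delta_{R'}$ is linear.
   Context: Algebras are associative with $1$ and not necessarily commutative. An $\mathbb{F}$-algebra $\mathcal{L}$ with $1$ is split local if $\mathcal{L}/\mathbf{J}(\mathcal{L})$ is isomorphic to $\mathbb{F}$, where $\mathbf{J}(\mathcal{L})$ is the Jacobson radical; it is called finite dimensional if $\mathbf{J}(\mathcal{L})$ has finite dimension over $\mathbb{F}$. $\mathrm{AGL}_n(\mathbb{F})$ is the subgroup of $\mathrm{GL}_{n+1}(\mathbb{F})$ consisting of the matrices with first column $(1,0,\dots,0)^{\mathrm T}$. A subgroup $R'\le\mathrm{AGL}_n(\mathbb{F})$ is regular if for every $v\in\mathbb{F}^n$ there is exactly one element of $R'$ with first row $(1,v)$; this element is written $\begin{pmatrix}1&v\\0&I_n+\delta_{R'}(v)\end{pmatrix}$, defining $\delta_{R'}:\mathbb{F}^n\to\mathrm{Mat}_n(\mathbb{F})$; "linear" means $\mathbb{F}$-linear. *)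

theory Defs
  imports "HOL-Algebra.QuotRing" "Jordan_Normal_Form.VS_Connect"
begin

text \<open>
  The underlying ring of an algebra is a type of class \<open>ring_1\<close>, so it has a 1 different from 0 and
  its multiplication need not commute; the scalar multiplication is the parameter \<open>scale\<close>. A split
  local algebra is nonzero, so nothing is lost by excluding the zero ring.
\<close>

locale assoc_algebra = vector_space scale
  for scale :: "'f::field \<Rightarrow> 'a::ring_1 \<Rightarrow> 'a" +
  assumes mult_scale_left: "scale c x * y = scale c (x * y)"
    and mult_scale_right: "x * scale c y = scale c (x * y)"

definition left_ideal :: "'a::ring_1 set \<Rightarrow> bool" where
  "left_ideal I \<longleftrightarrow> 0 \<in> I \<and> (\<forall>x\<in>I. \<forall>y\<in>I. x + y \<in> I) \<and> (\<forall>r. \<forall>x\<in>I. r * x \<in> I)"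

definition maximal_left_ideal :: "'a::ring_1 set \<Rightarrow> bool" where
  "maximal_left_ideal I \<longleftrightarrow>
     left_ideal I \<and> I \<noteq> UNIV \<and> (\<forall>K. left_ideal K \<longrightarrow> I \<subseteq> K \<longrightarrow> K = I \<or> K = UNIV)"

definition jacobson_radical :: "'a::ring_1 set" where
  "jacobson_radical = \<Inter> {I. maximal_left_ideal I}"

text \<open>
  The isomorphism in the definition of split local is one of algebras over the ground field: a ring
  isomorphism from the quotient onto the field that also respects the scalar action
  induced on cosets.
\<close>

definition split_local :: "('f::field \<Rightarrow> 'a::ring_1 \<Rightarrow> 'a) \<Rightarrow> bool" where
  "split_local scale \<longleftrightarrow>
     (\<exists>h \<in> ring_iso ((class_ring :: 'a ring) Quot jacobson_radical) (class_ring :: 'f ring).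
        \<forall>c x. h (jacobson_radical +>\<^bsub>class_ring\<^esub> scale c x)
            = c * h (jacobson_radical +>\<^bsub>class_ring\<^esub> x))"

definition finite_dim_radical :: "('f::field \<Rightarrow> 'a::ring_1 \<Rightarrow> 'a) \<Rightarrow> bool" where
  "finite_dim_radical scale \<longleftrightarrow>
     (\<exists>B. finite B \<and> Modules.module.span scale B = (jacobson_radical :: 'a set))"

definition one_plus_radical :: "'a::ring_1 monoid" where
  "one_plus_radical = \<lparr>carrier = {1 + v | v. v \<in> jacobson_radical}, mult = (*), one = 1\<rparr>"

definition GL :: "'f::field itself \<Rightarrow> nat \<Rightarrow> 'f mat monoid" where
  "GL ty m = units_of (ring_mat ty m ())"

definition AGL :: "'f::field itself \<Rightarrow> nat \<Rightarrow> 'f mat monoid" where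
  "AGL ty n = (GL ty (n + 1))
     \<lparr>carrier := {A \<in> carrier (GL ty (n + 1)). col A 0 = unit_vec (n + 1) 0}\<rparr>"

definition regular_subgroup :: "nat \<Rightarrow> 'f::field mat set \<Rightarrow> bool" where
  "regular_subgroup n R' \<longleftrightarrow> subgroup R' (AGL TYPE('f) n) \<and>
     (\<forall>v \<in> carrier_vec n. \<exists>!A. A \<in> R' \<and> row A 0 = vCons 1 v)"

text \<open>
  For a regular \<open>R'\<close> and a vector \<open>v\<close> of dimension \<open>n\<close> the matrix below is unique, because the first
  column of every element of \<open>R'\<close> is \<open>(1,0,...,0)\<close>.
\<close>

definition delta :: "nat \<Rightarrow> 'f::field mat set \<Rightarrow> 'f vec \<Rightarrow> 'f mat" where
  "delta n R' v = (THE D. D \<in> carrier_mat n n \<and>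
     four_block_mat (1\<^sub>m 1) (mat_of_row v) (0\<^sub>m n 1) (1\<^sub>m n + D) \<in> R')"

end

theory Submission
  imports Defs
begin

text \<open>
  Splitness gives \<open>L = F 1 + J\<close>, so the left ideal \<open>J\<close> is also a right ideal. An element \<open>1 + v\<close> with
  \<open>v \<in> J\<close> lies in no maximal left ideal, hence is left invertible, and \<open>1 + J\<close> is a group. In a basis
  \<open>1, b\<^sub>1, \<dots>, b\<^sub>n\<close> with \<open>b\<^sub>1, \<dots>, b\<^sub>n\<close> a basis of \<open>J\<close>, right multiplication by \<open>1 + v\<close> has
  first row \<open>(1, v)\<close> and first column \<open>(1, 0, \<dots>, 0)\<close>. Its lower right block is \<open>I + \<delta>(v)\<close>, where
  \<open>\<delta>(v)\<close> is right multiplication by \<open>v\<close> on \<open>J\<close>, which is linear in \<open>v\<close>.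
\<close>

section \<open>Left ideals and the Jacobson radical\<close>

lemma left_ideal_add: "left_ideal I \<Longrightarrow> x \<in> I \<Longrightarrow> y \<in> I \<Longrightarrow> x + y \<in> I"
  and left_ideal_mult: "left_ideal I \<Longrightarrow> x \<in> I \<Longrightarrow> r * x \<in> I"
  and left_ideal_zero: "left_ideal I \<Longrightarrow> 0 \<in> I"
  unfolding left_ideal_def by auto

lemma left_ideal_minus:
  assumes "left_ideal I" "x \<in> I"
  shows "- x \<in> I"
  using left_ideal_mult[OF assms, of "- 1"] by simp

lemma left_ideal_diff: "left_ideal I \<Longrightarrow> x \<in> I \<Longrightarrow> y \<in> I \<Longrightarrow> x - y \<in> I"
  using left_ideal_add[of I x "- y"] left_ideal_minus[of I y] by simp

lemma left_ideal_eq_UNIV_iff: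
  assumes "left_ideal I"
  shows "I = UNIV \<longleftrightarrow> 1 \<in> I"
  using left_ideal_mult[OF assms, of 1] by auto

lemma left_ideal_principal: "left_ideal {r * x | r. True}"
  unfolding left_ideal_def
  by (auto intro: exI[of _ 0] simp: distrib_right[symmetric] mult.assoc[symmetric])

lemma left_ideal_jacobson_radical: "left_ideal (jacobson_radical :: 'a::ring_1 set)"
proof -
  have "left_ideal I" if "maximal_left_ideal I" for I :: "'a set"
    using that unfolding maximal_left_ideal_def by simp
  then show ?thesis
    unfolding jacobson_radical_def left_ideal_def[of "\<Inter> _"]
    by (simp add: left_ideal_zero left_ideal_add left_ideal_mult)
qed

text \<open>Zorn's lemma applies because a left ideal is proper exactly when it misses
  \<open>1\<close>, and missing \<open>1\<close> passes to unions of chains.\<close>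

lemma proper_left_ideal_extends:
  fixes L :: "'a::ring_1 set"
  assumes L: "left_ideal L" and proper: "L \<noteq> UNIV"
  obtains K where "maximal_left_ideal K" "L \<subseteq> K"
proof -
  define P where "P = {I. left_ideal I \<and> 1 \<notin> I \<and> L \<subseteq> I}"
  have "P \<noteq> {}"
    using L proper left_ideal_eq_UNIV_iff[OF L] unfolding P_def by blast
  moreover have "\<Union>C \<in> P" if ne: "C \<noteq> {}" and ch: "subset.chain P C" for C
  proof -
    have C: "left_ideal I" "1 \<notin> I" "L \<subseteq> I" if "I \<in> C" for I
      using ch that unfolding subset.chain_def P_def by auto
    have "x + y \<in> \<Union>C" if "x \<in> \<Union>C" "y \<in> \<Union>C" for x y
    proof -
      obtain I K where IK: "I \<in> C" "x \<in> I" "K \<in> C" "y \<in> K"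
        using \<open>x \<in> \<Union>C\<close> \<open>y \<in> \<Union>C\<close> by blast
      then have "I \<subseteq> K \<or> K \<subseteq> I"
        using ch unfolding subset.chain_def by blast
      with IK show ?thesis
        using left_ideal_add[OF C(1)] by blast
    qed
    then have "left_ideal (\<Union>C)"
      unfolding left_ideal_def
      using ne C(1) left_ideal_zero left_ideal_mult by blast
    then show ?thesis
      using ne C unfolding P_def by blast
  qed
  ultimately obtain K where K: "K \<in> P" "\<And>X. X \<in> P \<Longrightarrow> K \<subseteq> X \<Longrightarrow> X = K"
    using subset_Zorn_nonempty[of P] by blast
  have "maximal_left_ideal K"
    unfolding maximal_left_ideal_def
  proof (intro conjI allI impI)
    show "left_ideal K" "K \<noteq> UNIV"
      using K(1) unfolding P_def by auto
    fix I assume I: "left_ideal I" "K \<subseteq> I"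
    show "I = K \<or> I = UNIV"
      using I K left_ideal_eq_UNIV_iff[OF I(1)] unfolding P_def by blast
  qed
  then show thesis
    using that K(1) unfolding P_def by blast
qed

text \<open>A maximal left ideal containing all multiples of \<open>1 + v\<close> would also contain
  \<open>v\<close>, hence \<open>1\<close>. A left inverse is enough here, since
  \<open>group_one_plus_J\<close> establishes the group through \<open>groupI\<close>, which asks
  for left inverses.\<close>

lemma one_plus_radical_left_inverse:
  assumes v: "v \<in> jacobson_radical"
  obtains u where "u * (1 + v) = 1"
proof -
  let ?L = "{r * (1 + v) | r. True}"
  have "?L = UNIV"
  proof (rule ccontr)
    assume "?L \<noteq> UNIV"
    then obtain K where K: "maximal_left_ideal K" "?L \<subseteq> K"
      using proper_left_ideal_extends[OF left_ideal_principal] by metis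
    have K': "left_ideal K" "K \<noteq> UNIV"
      using K(1) unfolding maximal_left_ideal_def by auto
    have "1 * (1 + v) \<in> K"
      using K(2) by blast
    moreover have "v \<in> K"
      using v K(1) unfolding jacobson_radical_def by blast
    ultimately have "1 \<in> K"
      using left_ideal_diff[OF K'(1), of "1 + v" v] by simp
    with K' show False
      using left_ideal_eq_UNIV_iff by blast
  qed
  then show thesis
    using that by (smt (verit) UNIV_I mem_Collect_eq)
qed

lemma one_plus_radical_simps:
  "x \<otimes>\<^bsub>one_plus_radical\<^esub> y = x * y" "\<one>\<^bsub>one_plus_radical\<^esub> = 1"
  by (simp_all add: one_plus_radical_def)

section \<open>Split local algebras and the group \<open>1 + J\<close>\<close>

context assoc_algebra
begin

lemma scale_eq_mult: "scale c x = scale c 1 * x"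
  using mult_scale_left[of c 1 x] by simp

lemma left_ideal_scale: "left_ideal I \<Longrightarrow> x \<in> I \<Longrightarrow> scale c x \<in> I"
  using left_ideal_mult[of I x "scale c 1"] by (simp add: scale_eq_mult[symmetric])

lemma left_ideal_subspace: "left_ideal I \<Longrightarrow> subspace I"
  by (rule subspaceI) (auto intro: left_ideal_zero left_ideal_add left_ideal_scale)

end

locale split_local_algebra = assoc_algebra scale
  for scale :: "'f::field \<Rightarrow> 'a::ring_1 \<Rightarrow> 'a" +
  assumes split: "split_local scale"
begin

abbreviation J :: "'a set" where "J \<equiv> jacobson_radical"

lemmas J_left = left_ideal_jacobson_radical[where 'a = 'a]

text \<open>Splitness enters the later arguments through these two facts: \<open>J\<close> is
  proper, and the scalars together with \<open>J\<close> fill the whole algebra.\<close>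

lemma one_notin_J: "1 \<notin> J"
  and radical_complement: "\<exists>c. x - scale c 1 \<in> J"
proof -
  let ?A = "class_ring :: 'a ring" and ?F = "class_ring :: 'f ring"
  obtain h where h: "h \<in> ring_iso (?A Quot J) ?F"
    and hs: "\<And>c x. h (J +>\<^bsub>?A\<^esub> scale c x) = c * h (J +>\<^bsub>?A\<^esub> x)"
    using split unfolding split_local_def by blast
  \<comment> \<open>\<open>J\<close> is known only as a left ideal at this point
    (\<open>J_right\<close> depends on this lemma), so cosets are handled through the additive
    group.\<close>
  have "subgroup J (add_monoid ?A)"
  proof (rule group.subgroupI[OF abelian_group.a_group[OF class_ring.abelian_group_axioms]])
    fix x assume "x \<in> J"
    then have "\<ominus>\<^bsub>?A\<^esub> x \<in> J"
      using left_ideal_minus[OF J_left] by (simp add: class_ring_simps)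
    then show "inv\<^bsub>add_monoid ?A\<^esub> x \<in> J"
      by (simp only: a_inv_def)
  qed (use left_ideal_zero[OF J_left] left_ideal_add[OF J_left] in auto)
  then interpret abelian_subgroup J ?A
    by (intro abelian_subgroupI3 additive_subgroupI class_ring.abelian_group_axioms)
  have carr: "J +>\<^bsub>?A\<^esub> x \<in> carrier (?A Quot J)" for x
    unfolding FactRing_def by (auto simp: A_RCOSETS_def')
  have hom: "h \<in> Ring.ring_hom (?A Quot J) ?F" and inj: "inj_on h (carrier (?A Quot J))"
    using h unfolding ring_iso_def bij_betw_def by auto
  have hadd: "h (J +>\<^bsub>?A\<^esub> (x + y)) = h (J +>\<^bsub>?A\<^esub> x) + h (J +>\<^bsub>?A\<^esub> y)" for x y
    using ring_hom_add[OF hom carr carr, of x y] a_rcos_sum[of x y] by (simp add: FactRing_def)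
  have h1: "h (J +>\<^bsub>?A\<^esub> 1) = 1"
    using ring_hom_one[OF hom] by (simp add: FactRing_def)
  have h0: "h (J +>\<^bsub>?A\<^esub> 0) = 0"
    using hs[of 0 0] by simp
  have J0: "J +>\<^bsub>?A\<^esub> 0 = J"
    by (simp add: a_r_coset_def')
  \<comment> \<open>Injectivity of \<open>h\<close> on cosets makes \<open>J\<close> the kernel of
    the composite map from the algebra to the field.\<close>
  have ker: "x \<in> J \<longleftrightarrow> h (J +>\<^bsub>?A\<^esub> x) = 0" for x
  proof
    assume "x \<in> J"
    then have "J +>\<^bsub>?A\<^esub> x = J"
      by (rule a_rcos_const)
    then show "h (J +>\<^bsub>?A\<^esub> x) = 0"
      using h0 J0 by simp
  next
    assume "h (J +>\<^bsub>?A\<^esub> x) = 0"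
    then have "J +>\<^bsub>?A\<^esub> x = J"
      using inj_onD[OF inj _ carr carr, of x 0] h0 J0 by simp
    then show "x \<in> J"
      using a_rcos_self[of x] by simp
  qed
  show "1 \<notin> J"
    using ker h1 by simp
  \<comment> \<open>The scalar part of \<open>x\<close> is its image in the field: \<open>h\<close>
    sends the coset of \<open>scale c 1\<close> to \<open>c\<close>, so the difference lies in the
    kernel.\<close>
  let ?c = "h (J +>\<^bsub>?A\<^esub> x)"
  have "h (J +>\<^bsub>?A\<^esub> (x + scale (- ?c) 1)) = 0"
    by (simp only: hadd hs h1) simp
  then show "\<exists>c. x - scale c 1 \<in> J"
    using ker by (intro exI[of _ ?c]) (simp add: scale_minus_left)
qed

text \<open>Split the right factor \<open>y\<close> into a scalar and an element of
  \<open>J\<close>: the scalar only rescales \<open>x\<close>, and the rest is a left multiple of an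
  element of \<open>J\<close>.\<close>

lemma J_right:
  assumes "x \<in> J"
  shows "x * y \<in> J"
proof -
  obtain c where c: "y - scale c 1 \<in> J"
    using radical_complement by blast
  have "x * y = x * (y - scale c 1) + scale c x"
    by (simp add: right_diff_distrib mult_scale_right)
  moreover have "x * (y - scale c 1) + scale c x \<in> J"
    using assms c by (intro left_ideal_add left_ideal_mult left_ideal_scale J_left)
  ultimately show ?thesis
    by (simp only:)
qed

lemma one_plus_J_iff: "x \<in> carrier one_plus_radical \<longleftrightarrow> x - 1 \<in> J"
proof
  assume "x \<in> carrier one_plus_radical"
  then obtain v where "x = 1 + v" "v \<in> J"
    unfolding one_plus_radical_def by auto
  then show "x - 1 \<in> J" by simp
next
  assume "x - 1 \<in> J"
  then have "x = 1 + (x - 1) \<and> x - 1 \<in> J" by simp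
  then show "x \<in> carrier one_plus_radical"
    unfolding one_plus_radical_def partial_object.simps by blast
qed

lemma group_one_plus_J: "group (one_plus_radical :: 'a monoid)"
proof (rule groupI)
  fix x y z :: 'a
  assume x: "x \<in> carrier one_plus_radical"
  obtain u where u: "u * x = 1"
    using one_plus_radical_left_inverse[of "x - 1"] x by (auto simp: one_plus_J_iff)
  \<comment> \<open>The left inverse \<open>u\<close> was found somewhere in the algebra; this
    identity places it in \<open>1 + J\<close>.\<close>
  have "u - 1 = - (u * (x - 1))"
    using u by (simp add: right_diff_distrib)
  then have "u - 1 \<in> J"
    using x J_left by (simp add: one_plus_J_iff left_ideal_mult left_ideal_minus)
  then show "\<exists>y \<in> carrier one_plus_radical. y \<otimes>\<^bsub>one_plus_radical\<^esub> x = \<one>\<^bsub>one_plus_radical\<^esub>"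
    using u by (auto simp: one_plus_radical_simps one_plus_J_iff)
  show "x \<otimes>\<^bsub>one_plus_radical\<^esub> y \<otimes>\<^bsub>one_plus_radical\<^esub> z
      = x \<otimes>\<^bsub>one_plus_radical\<^esub> (y \<otimes>\<^bsub>one_plus_radical\<^esub> z)"
    by (simp add: one_plus_radical_simps mult.assoc)
  show "\<one>\<^bsub>one_plus_radical\<^esub> \<otimes>\<^bsub>one_plus_radical\<^esub> x = x"
    by (simp add: one_plus_radical_simps)
  assume y: "y \<in> carrier one_plus_radical"
  have "x * y - 1 = x * (y - 1) + (x - 1)"
    by (simp add: right_diff_distrib)
  moreover have "x * (y - 1) + (x - 1) \<in> J"
    using x y J_left by (intro left_ideal_add left_ideal_mult) (simp_all add: one_plus_J_iff)
  ultimately show "x \<otimes>\<^bsub>one_plus_radical\<^esub> y \<in> carrier one_plus_radical"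
    by (simp only: one_plus_radical_simps one_plus_J_iff)
next
  show "\<one>\<^bsub>one_plus_radical\<^esub> \<in> carrier (one_plus_radical :: 'a monoid)"
    using left_ideal_zero[OF J_left] by (simp add: one_plus_radical_simps one_plus_J_iff)
qed

end

section \<open>Matrices of right multiplications\<close>

text \<open>
  Vectors are rows, as in the paper: \<open>M y\<close> is the matrix of the right multiplication by \<open>y\<close>, acting
  on coordinate rows from the right, so that \<open>M\<close> preserves the order of products.
\<close>

locale algebra_basis = assoc_algebra scale
  for scale :: "'f::field \<Rightarrow> 'a::ring_1 \<Rightarrow> 'a" +
  fixes m :: nat and b :: "nat \<Rightarrow> 'a" and coord :: "nat \<Rightarrow> 'a \<Rightarrow> 'f"
  assumes coord_add: "coord i (x + y) = coord i x + coord i y"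
    and coord_scale: "coord i (scale a x) = a * coord i x"
    and coord_basis: "i < m \<Longrightarrow> j < m \<Longrightarrow> coord j (b i) = (if i = j then 1 else 0)"
    and expand: "x = (\<Sum>i<m. scale (coord i x) (b i))"
begin

definition M :: "'a \<Rightarrow> 'f mat" where
  "M y = mat m m (\<lambda>(i, j). coord j (b i * y))"

lemma M_carrier [simp]: "M y \<in> carrier_mat m m"
  by (simp add: M_def)

lemma M_dim [simp]: "dim_row (M y) = m" "dim_col (M y) = m"
  by (simp_all add: M_def)

lemma coord_zero [simp]: "coord i 0 = 0"
  using coord_scale[of i 0 0] by simp

lemma coord_sum: "coord i (sum f A) = (\<Sum>k\<in>A. coord i (f k))"
  by (induction A rule: infinite_finite_induct) (simp_all add: coord_add)

lemma coord_eqI: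
  assumes "\<And>i. i < m \<Longrightarrow> coord i x = coord i y"
  shows "x = y"
proof -
  have "x = (\<Sum>i<m. scale (coord i x) (b i))"
    by (rule expand)
  also have "\<dots> = (\<Sum>i<m. scale (coord i y) (b i))"
    using assms by simp
  also have "\<dots> = y"
    by (rule expand[symmetric])
  finally show ?thesis .
qed

lemma M_one: "M 1 = 1\<^sub>m m"
  by (rule eq_matI) (simp_all add: M_def coord_basis)

lemma M_mult: "M (y * z) = M y * M z"
proof (rule eq_matI)
  fix i j assume "i < dim_row (M y * M z)" "j < dim_col (M y * M z)"
  then have ij: "i < m" "j < m" by simp_all
  have "b i * (y * z) = b i * y * z"
    by (simp add: mult.assoc)
  \<comment> \<open>Expanding \<open>b i * y\<close> before multiplying by \<open>z\<close> makes
    the coefficients row \<open>i\<close> of \<open>M y\<close>, paired with the rows of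
    \<open>M z\<close>.\<close>
  also have "\<dots> = (\<Sum>k<m. scale (coord k (b i * y)) (b k)) * z"
    by (rule arg_cong[OF expand])
  also have "\<dots> = (\<Sum>k<m. scale (coord k (b i * y)) (b k * z))"
    by (simp add: sum_distrib_right mult_scale_left)
  finally have "coord j (b i * (y * z)) = (\<Sum>k<m. coord k (b i * y) * coord j (b k * z))"
    by (simp only: coord_sum coord_scale)
  then show "M (y * z) $$ (i, j) = (M y * M z) $$ (i, j)"
    using ij by (simp add: M_def scalar_prod_def atLeast0LessThan)
qed simp_all

end

section \<open>The regular subgroup obtained from a basis adapted to \<open>J\<close>\<close>

locale adapted_basis =
  split_local_algebra scale + algebra_basis scale "Suc n" b coord
  for scale :: "'f::field \<Rightarrow> 'a::ring_1 \<Rightarrow> 'a" and n b coord +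
  assumes basis_0: "b 0 = 1"
    and J_iff: "x \<in> J \<longleftrightarrow> coord 0 x = 0"
begin

definition R :: "'f mat set" where
  "R = M ` carrier one_plus_radical"

text \<open>The linear isomorphism from coordinate rows of length \<open>n\<close> onto
  \<open>J\<close>. Indices shift by one because \<open>b 0\<close> is \<open>1\<close>, while
  \<open>b 1\<close>, ..., \<open>b n\<close> form a basis of \<open>J\<close>.\<close>

definition rad_elt :: "'f vec \<Rightarrow> 'a" where
  "rad_elt v = (\<Sum>i<n. scale (v $ i) (b (Suc i)))"

lemma coord_one: "j < Suc n \<Longrightarrow> coord j 1 = (if j = 0 then 1 else 0)"
  using coord_basis[of 0 j] by (simp add: basis_0)

lemma coord_diff: "coord i (x - y) = coord i x - coord i y"
  using coord_add[of i "x - y" y] by simp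

lemma one_plus_J_coord: "x \<in> carrier one_plus_radical \<longleftrightarrow> coord 0 x = 1"
  by (simp add: one_plus_J_iff J_iff coord_diff coord_one)

text \<open>This is the first column of \<open>M x\<close>. Its entries below the top vanish because
  \<open>J\<close> is a right ideal and coordinate \<open>0\<close> vanishes on
  \<open>J\<close>.\<close>

lemma coord_0_basis_mult:
  assumes "i < Suc n" "x \<in> carrier one_plus_radical"
  shows "coord 0 (b i * x) = (if i = 0 then 1 else 0)"
proof (cases "i = 0")
  case True
  then show ?thesis
    using assms by (simp add: basis_0 one_plus_J_coord)
next
  case False
  then have "b i \<in> J"
    using assms(1) by (simp add: J_iff coord_basis)
  then show ?thesis
    using False J_right[of "b i" x] by (simp add: J_iff)
qed

lemma one_plus_J_inverse:
  fixes x :: 'a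
  assumes "x \<in> carrier one_plus_radical"
  obtains u where "u \<in> carrier one_plus_radical" "u * x = 1" "x * u = 1"
  using group.l_inv[OF group_one_plus_J assms] group.r_inv[OF group_one_plus_J assms]
    group.inv_closed[OF group_one_plus_J assms]
  by (simp add: one_plus_radical_simps)

lemma AGL_simps:
  "x \<otimes>\<^bsub>AGL TYPE('f) n\<^esub> y = x * y"
  "\<one>\<^bsub>AGL TYPE('f) n\<^esub> = 1\<^sub>m (Suc n)"
  "A \<in> carrier (AGL TYPE('f) n) \<longleftrightarrow> A \<in> carrier_mat (Suc n) (Suc n) \<and>
     (\<exists>B \<in> carrier_mat (Suc n) (Suc n). B * A = 1\<^sub>m (Suc n) \<and> A * B = 1\<^sub>m (Suc n)) \<and>
     col A 0 = unit_vec (Suc n) 0"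
  by (auto simp: AGL_def GL_def units_of_def Units_def ring_mat_simps)

lemma M_in_AGL:
  assumes x: "x \<in> carrier one_plus_radical"
  shows "M x \<in> carrier (AGL TYPE('f) n)"
proof -
  obtain u where "u * x = 1" "x * u = 1"
    using one_plus_J_inverse[OF x] by blast
  then have "M u * M x = 1\<^sub>m (Suc n)" "M x * M u = 1\<^sub>m (Suc n)"
    by (simp_all add: M_mult[symmetric] M_one)
  moreover have "col (M x) 0 = unit_vec (Suc n) 0"
    by (rule eq_vecI) (simp_all add: M_def coord_0_basis_mult[OF _ x])
  ultimately show ?thesis
    using M_carrier by (auto simp: AGL_simps)
qed

text \<open>Used for closure of \<open>R\<close> under inverses. The argument works directly from
  \<open>m_inv_def\<close>: \<open>M u\<close> is a two-sided inverse in the carrier, and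
  associativity forces any other one to equal it.\<close>

lemma inv_AGL_M:
  assumes u: "u \<in> carrier one_plus_radical" "u * x = 1" "x * u = 1"
  shows "inv\<^bsub>AGL TYPE('f) n\<^esub> (M x) = M u"
  unfolding m_inv_def AGL_simps(1,2)
proof (rule the_equality)
  have ux: "M u * M x = 1\<^sub>m (Suc n)" "M x * M u = 1\<^sub>m (Suc n)"
    using u by (simp_all add: M_mult[symmetric] M_one)
  then show "M u \<in> carrier (AGL TYPE('f) n) \<and> M x * M u = 1\<^sub>m (Suc n) \<and> M u * M x = 1\<^sub>m (Suc n)"
    using M_in_AGL[OF u(1)] by blast
  fix B assume B: "B \<in> carrier (AGL TYPE('f) n) \<and> M x * B = 1\<^sub>m (Suc n) \<and> B * M x = 1\<^sub>m (Suc n)"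
  then have Bc: "B \<in> carrier_mat (Suc n) (Suc n)"
    by (simp add: AGL_simps)
  have "B = B * (M x * M u)"
    using Bc ux by simp
  also have "\<dots> = B * M x * M u"
    by (rule assoc_mult_mat[OF Bc M_carrier M_carrier, symmetric])
  also have "\<dots> = M u"
    using B M_carrier[of u] by simp
  finally show "B = M u" .
qed

text \<open>Row \<open>0\<close> describes \<open>1 * y\<close>, because \<open>b 0 = 1\<close>.
  Hence \<open>y\<close> can be recovered from \<open>M y\<close>, which yields both the injectivity
  of \<open>M\<close> and the regularity of \<open>R\<close>.\<close>

lemma M_row_0: "j < Suc n \<Longrightarrow> M y $$ (0, j) = coord j y"
  by (simp add: M_def basis_0)

lemma M_inj: "M x = M y \<Longrightarrow> x = y"
  by (rule coord_eqI) (metis M_row_0)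

lemma subgroup_R: "subgroup R (AGL TYPE('f) n)"
proof (rule subgroup.intro)
  show "R \<subseteq> carrier (AGL TYPE('f) n)"
    unfolding R_def using M_in_AGL by blast
  show "\<one>\<^bsub>AGL TYPE('f) n\<^esub> \<in> R"
    unfolding R_def AGL_simps M_one[symmetric] by (simp add: one_plus_J_coord coord_one)
  fix A assume "A \<in> R"
  then obtain x where x: "x \<in> carrier one_plus_radical" "A = M x"
    unfolding R_def by blast
  obtain u where "u \<in> carrier one_plus_radical" "u * x = 1" "x * u = 1"
    using one_plus_J_inverse[OF x(1)] by blast
  then show "inv\<^bsub>AGL TYPE('f) n\<^esub> A \<in> R"
    using inv_AGL_M x(2) unfolding R_def by simp
  fix B assume "B \<in> R"
  then obtain y where y: "y \<in> carrier one_plus_radical" "B = M y"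
    unfolding R_def by blast
  have "x * y \<in> carrier one_plus_radical"
    using monoid.m_closed[OF group.is_monoid[OF group_one_plus_J] x(1) y(1)]
    by (simp add: one_plus_radical_simps)
  then show "A \<otimes>\<^bsub>AGL TYPE('f) n\<^esub> B \<in> R"
    unfolding R_def AGL_simps x(2) y(2) M_mult[symmetric] by simp
qed

lemma coord_rad_elt: "j < Suc n \<Longrightarrow> coord j (rad_elt v) = (if j = 0 then 0 else v $ (j - 1))"
  by (auto simp: rad_elt_def coord_sum coord_scale coord_basis if_distrib gr0_conv_Suc cong: if_cong)

lemma rad_elt_in: "1 + rad_elt v \<in> carrier one_plus_radical"
  by (simp add: one_plus_J_coord coord_add coord_one coord_rad_elt)

text \<open>Both existence and uniqueness in the definition of regularity come from this. The
  element \<open>x\<close> is arbitrary: the leading \<open>1\<close> of the row already forces it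
  into \<open>1 + J\<close>.\<close>

lemma row_M_iff:
  assumes v: "v \<in> carrier_vec n"
  shows "row (M x) 0 = vCons 1 v \<longleftrightarrow> x = 1 + rad_elt v"
proof
  have e: "coord j (1 + rad_elt v) = vCons 1 v $ j" if "j < Suc n" for j
    using that by (cases j) (simp_all add: coord_add coord_one coord_rad_elt)
  have r: "row (M y) 0 $ j = coord j y" if "j < Suc n" for y j
    using that by (simp add: M_row_0)
  show "x = 1 + rad_elt v" if "row (M x) 0 = vCons 1 v"
    by (rule coord_eqI) (metis e r that)
  show "row (M x) 0 = vCons 1 v" if x: "x = 1 + rad_elt v"
  proof (rule eq_vecI)
    fix j assume "j < dim_vec (vCons 1 v)"
    then have "j < Suc n"
      using v by simp
    then show "row (M x) 0 $ j = vCons 1 v $ j"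
      by (simp only: r e x)
  qed (use v in simp)
qed

lemma regular_R: "regular_subgroup n R"
  unfolding regular_subgroup_def
proof (intro conjI ballI subgroup_R)
  fix v :: "'f vec" assume v: "v \<in> carrier_vec n"
  show "\<exists>!A. A \<in> R \<and> row A 0 = vCons 1 v"
  proof (rule ex1I[of _ "M (1 + rad_elt v)"])
    show "M (1 + rad_elt v) \<in> R \<and> row (M (1 + rad_elt v)) 0 = vCons 1 v"
      using rad_elt_in row_M_iff[OF v] by (simp add: R_def)
  next
    fix A assume "A \<in> R \<and> row A 0 = vCons 1 v"
    then show "A = M (1 + rad_elt v)"
      using row_M_iff[OF v] by (auto simp: R_def)
  qed
qed

lemma iso_R: "(one_plus_radical :: 'a monoid) \<cong> (AGL TYPE('f) n)\<lparr>carrier := R\<rparr>"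
proof (rule is_isoI)
  show "M \<in> iso one_plus_radical ((AGL TYPE('f) n)\<lparr>carrier := R\<rparr>)"
    unfolding iso_def hom_def bij_betw_def
    by (auto simp: R_def AGL_simps one_plus_radical_simps M_mult intro!: inj_onI dest: M_inj)
qed

section \<open>The map \<open>delta\<close> of the regular subgroup and its linearity\<close>

lemma delta_R:
  assumes v: "v \<in> carrier_vec n"
  shows "delta n R v = mat n n (\<lambda>(i, j). coord (Suc j) (b (Suc i) * rad_elt v))"
    (is "_ = ?D")
  unfolding delta_def
proof (rule the_equality)
  let ?block = "\<lambda>D. four_block_mat (1\<^sub>m 1) (mat_of_row v) (0\<^sub>m n 1) (1\<^sub>m n + D)"
  let ?x = "1 + rad_elt v"
  \<comment> \<open>In the lower right block, the summand \<open>1\<close> of \<open>?x\<close>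
    contributes the identity and \<open>rad_elt v\<close> contributes \<open>?D\<close>, the matrix
    of right multiplication by \<open>rad_elt v\<close> on \<open>J\<close>.\<close>
  have block: "?block ?D = M ?x"
  proof (rule eq_matI)
    fix i j assume "i < dim_row (M ?x)" "j < dim_col (M ?x)"
    then have ij: "i < Suc n" "j < Suc n" by simp_all
    show "?block ?D $$ (i, j) = M ?x $$ (i, j)"
    proof (cases j)
      case 0
      then show ?thesis
        using ij v coord_0_basis_mult[OF ij(1) rad_elt_in[of v]] by (cases i) (simp_all add: M_def)
    next
      case (Suc k)
      then show ?thesis
        using ij v
        by (cases i) (simp_all add: M_def mat_of_row_def basis_0 coord_add coord_one coord_rad_elt
            distrib_left coord_basis)
    qed
  qed simp_all
  then show "?D \<in> carrier_mat n n \<and> ?block ?D \<in> R"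
    using rad_elt_in by (simp add: R_def)
  fix D assume D: "D \<in> carrier_mat n n \<and> ?block D \<in> R"
  then obtain y where y: "?block D = M y"
    by (auto simp: R_def)
  \<comment> \<open>For uniqueness, the first row identifies the element \<open>y\<close> behind any
    competing block matrix, so the two block matrices agree and their lower right blocks can be
    compared.\<close>
  have "row (?block D) 0 = vCons 1 v"
  proof (rule eq_vecI)
    fix j assume "j < dim_vec (vCons 1 v)"
    then show "row (?block D) 0 $ j = vCons 1 v $ j"
      using v D by (cases j) (auto simp: mat_of_row_def)
  qed (use v D in auto)
  then have eq: "?block D = ?block ?D"
    using row_M_iff[OF v] y block by simp
  show "D = ?D"
  proof (rule eq_matI)
    fix i j assume "i < dim_row ?D" "j < dim_col ?D"
    then have "i < n" "j < n" by simp_all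
    moreover have "dim_row D = n" "dim_col D = n"
      using D by auto
    ultimately show "D $$ (i, j) = ?D $$ (i, j)"
      using arg_cong[OF eq, of "\<lambda>A. A $$ (Suc i, Suc j)"] by simp
  qed (use D in auto)
qed

text \<open>By \<open>delta_R\<close> each entry is a composite of linear maps: \<open>v\<close>
  goes to \<open>rad_elt v\<close>, which is multiplied on the left by a fixed basis vector, and
  then one coordinate is taken.\<close>

lemma linear_delta:
  "linear_map class_ring (module_vec TYPE('f) n) (module_mat TYPE('f) n n) (delta n R)"
proof -
  have add: "rad_elt (v + w) = rad_elt v + rad_elt w"
    if "v \<in> carrier_vec n" "w \<in> carrier_vec n" for v w
    using that by (simp add: rad_elt_def scale_left_distrib sum.distrib)
  have smult: "rad_elt (a \<cdot>\<^sub>v v) = scale a (rad_elt v)" if "v \<in> carrier_vec n" for a v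
    using that by (simp add: rad_elt_def scale_sum_right)
  have "delta n R \<in> LinearCombinations.module_hom class_ring (module_vec TYPE('f) n) (module_mat TYPE('f) n n)"
    unfolding LinearCombinations.module_hom_def
  proof (intro CollectI conjI allI impI)
    show "delta n R \<in> carrier (module_vec TYPE('f) n) \<rightarrow> carrier (module_mat TYPE('f) n n)"
      by (auto simp: module_vec_simps module_mat_simps delta_R)
    show "delta n R (v \<oplus>\<^bsub>module_vec TYPE('f) n\<^esub> w)
        = delta n R v \<oplus>\<^bsub>module_mat TYPE('f) n n\<^esub> delta n R w"
      if "v \<in> carrier (module_vec TYPE('f) n) \<and> w \<in> carrier (module_vec TYPE('f) n)" for v w
      using that
      by (intro eq_matI)
        (auto simp: module_vec_simps module_mat_simps delta_R add distrib_left coord_add)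
    show "delta n R (a \<odot>\<^bsub>module_vec TYPE('f) n\<^esub> v)
        = a \<odot>\<^bsub>module_mat TYPE('f) n n\<^esub> delta n R v"
      if "a \<in> carrier class_ring \<and> v \<in> carrier (module_vec TYPE('f) n)" for a v
      using that
      by (intro eq_matI)
        (auto simp: module_vec_simps module_mat_simps delta_R smult mult_scale_right coord_scale)
  qed
  then show ?thesis
    unfolding linear_map_def mod_hom_def mod_hom_axioms_def
    using vec_vs matrix_vs vec_module vectorspace.axioms(1)[OF matrix_vs] by blast
qed

end

section \<open>Existence of an adapted basis\<close>

lemma (in split_local_algebra) adapted_basis_exists:
  assumes "finite_dim_radical scale"
  shows "\<exists>b coord. adapted_basis scale (dim J) b coord"
proof -
  obtain B0 where B0: "finite B0" "span B0 = J"
    using assms unfolding finite_dim_radical_def by blast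
  obtain B where B: "B \<subseteq> J" "independent B" "J \<subseteq> span B" "card B = dim J"
    using basis_exists by blast
  have "finite B"
    using independent_span_bound[OF B0(1) B(2)] B(1) B0(2) by simp
  have spanB: "span B = J"
    using B span_minimal[OF B(1) left_ideal_subspace[OF J_left]] by blast
  \<comment> \<open>Adjoining \<open>1\<close> to a basis of \<open>J\<close> gives a basis of the
    algebra: independence comes from \<open>1 \<notin> J\<close>, spanning from
    \<open>radical_complement\<close>.\<close>
  define C where "C = insert 1 B"
  have "1 \<notin> B"
    using B(1) one_notin_J by blast
  have "independent C"
    unfolding C_def using B(2) spanB one_notin_J by (simp add: independent_insert)
  have spanC: "x \<in> span C" for x
    using radical_complement[of x] unfolding C_def span_insert spanB by simp
  have "finite C"
    using \<open>finite B\<close> by (simp add: C_def)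
  obtain f where f: "bij_betw f {..<dim J} B"
    using ex_bij_betw_nat_finite[OF \<open>finite B\<close>] B(4) by (auto simp: atLeast0LessThan)
  \<comment> \<open>Index \<open>0\<close> is reserved for \<open>1\<close>, and the enumeration
    \<open>f\<close> of \<open>B\<close> moves up by one.\<close>
  define b where "b = case_nat 1 f"
  define coord where "coord = (\<lambda>i x. representation C x (b i))"
  have b_simps: "b 0 = 1" "b (Suc i) = f i" for i
    by (simp_all add: b_def)
  have bij: "bij_betw b {..<Suc (dim J)} C"
  proof -
    have "bij_betw (\<lambda>i. f (i - 1)) (Suc ` {..<dim J}) B"
      using f by (auto simp: bij_betw_def inj_on_def image_image)
    then have "bij_betw b (Suc ` {..<dim J}) B"
      by (rule bij_betw_cong[THEN iffD1, rotated]) (auto simp: b_simps)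
    then show ?thesis
      unfolding C_def lessThan_Suc_eq_insert_0
      using notIn_Un_bij_betw[of 0 "Suc ` {..<dim J}" b B] \<open>1 \<notin> B\<close> by (simp add: b_simps)
  qed
  have expand: "x = (\<Sum>i<Suc (dim J). scale (coord i x) (b i))" for x
  proof -
    have "x = (\<Sum>c\<in>C. scale (representation C x c) c)"
      using sum_representation_eq[OF \<open>independent C\<close> spanC \<open>finite C\<close> subset_refl] by simp
    also have "\<dots> = (\<Sum>i<Suc (dim J). scale (coord i x) (b i))"
      unfolding coord_def by (rule sum.reindex_bij_betw[OF bij, symmetric])
    finally show ?thesis .
  qed
  have coord_basis: "coord j (b i) = (if i = j then 1 else 0)"
    if "i < Suc (dim J)" "j < Suc (dim J)" for i j
    using that bij bij_betwE[OF bij]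
    by (auto simp: coord_def representation_basis[OF \<open>independent C\<close>] bij_betw_def dest: inj_onD)
  have "x \<in> J \<longleftrightarrow> coord 0 x = 0" for x
  proof
    assume "x \<in> J"
    \<comment> \<open>An element of \<open>span B\<close> has the same representation over
      \<open>C\<close> as over \<open>B\<close>, and the latter is zero at \<open>1\<close> because
      \<open>1 \<notin> B\<close>.\<close>
    then have "representation C x = representation B x"
      using representation_extend[OF \<open>independent C\<close>, of x B] spanB by (auto simp: C_def)
    then show "coord 0 x = 0"
      using \<open>1 \<notin> B\<close> representation_ne_zero[of B x 1] by (auto simp: coord_def b_simps)
  next
    assume "coord 0 x = 0"
    \<comment> \<open>With the term at index \<open>0\<close> gone, only multiples of elements of
      \<open>B\<close> remain, all of which lie in \<open>J\<close>.\<close>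
    then have "x = (\<Sum>i<dim J. scale (coord (Suc i) x) (f i))"
      using expand[of x] by (simp add: sum.lessThan_Suc_shift b_simps del: sum.lessThan_Suc)
    moreover have "f i \<in> J" if "i < dim J" for i
      using f B(1) that by (auto simp: bij_betw_def)
    ultimately show "x \<in> J"
      using subspace_sum[OF left_ideal_subspace[OF J_left]] left_ideal_scale[OF J_left]
      by (metis (no_types, lifting) lessThan_iff)
  qed
  then have "adapted_basis scale (dim J) b coord"
    using expand coord_basis spanC
    by unfold_locales
      (auto simp: b_simps coord_def representation_add[OF \<open>independent C\<close>]
        representation_scale[OF \<open>independent C\<close>])
  then show ?thesis
    by blast
qed

theorem theorem3p1:
  fixes scale :: "'f::field \<Rightarrow> 'a::ring_1 \<Rightarrow> 'a"
    and n :: nat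
  assumes "assoc_algebra scale"
    and "split_local scale"
    and "finite_dim_radical scale"
    and "n = vector_space.dim scale (jacobson_radical :: 'a set)"
  shows "group (one_plus_radical :: 'a monoid) \<and>
    (\<exists>R' :: 'f mat set. regular_subgroup n R' \<and>
       (one_plus_radical :: 'a monoid) \<cong> (AGL TYPE('f) n)\<lparr>carrier := R'\<rparr> \<and>
       linear_map class_ring (module_vec TYPE('f) n) (module_mat TYPE('f) n n) (delta n R'))"
proof -
  interpret split_local_algebra scale
    using assms(1,2) by (simp add: split_local_algebra_def split_local_algebra_axioms_def)
  obtain b coord where "adapted_basis scale n b coord"
    using adapted_basis_exists[OF assms(3)] assms(4) by blast
  then interpret adapted_basis scale n b coord .
  show ?thesis
    using group_one_plus_J regular_R iso_R linear_delta by blast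
qed

end
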